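(* Let $q$ be a prime power, $m\ge1$, $1\le k\le q-1$, and let $d=q+1-k$ be the minimum distance of $\mathrm{PRS}_q(k)$. Put $\theta_{m,q}=\frac{q^{m+1}-1}{q-1}$. Then the minimum distance $D$ of $\mathrm{PLift}_q(m,k)$ satisfies $$D\ge(d-1)\,\theta_{m-1,q}+1.$$ As a consequence, the relative distances $\delta=d/(q+1)$ of $\mathrm{PRS}_q(k)$ and $\Delta=D/\theta_{m,q}$ of $\mathrm{PLift}_q(m,k)$ satisfy $\Delta\ge(1-b')\delta-b'$ for some $b'$ with $0\le b'\le q^{-1}$.
   Context: $\mathbb P^m=(\mathbb F_q^{m+1}\setminus\{0\})/\mathbb F_q^\times$; the standard representative of a point is the one whose leftmost non-zero coordinate is $1$. $\mathbb F_q[\mathbf X]^H_v$ is the space of homogeneous polynomials of degree $v$ in $X_0,\dots,X_m$ (together with $0$), and $\mathrm{ev}_{\mathbb P^m}(f)=(f(\mathbf P))_{\mathbf P\in\mathbb P^m}$, evaluating at standard representatives. $\mathrm{PRS}_q(k)=\{\mathrm{ev}_{\mathbb P^1}(g): g\in\mathbb F_q[S,T]^H_k\}$, a code of length $q+1$ and dimension $k+1$. $\mathrm{Emb}_{\mathbb P}(m)$ is the set of injective $\mathbb F_q$-linear maps $L:\mathbb F_q^2\to\mathbb F_q^{m+1}$, and $f\circ L=f(L(S,T))$. For $v=k+(m-1)(q-1)$, $$\mathrm{PLift}_q(m,k)=\{\mathrm{ev}_{\mathbb P^m}(f): f\in\mathbb F_q[\mathbf X]^H_v,\ \forall L\in\mathrm{Emb}_{\mathbb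 P}(m),\ \mathrm{ev}_{\mathbb P^1}(f\circ L)\in\mathrm{PRS}_q(k)\},$$ a code of length $\theta_{m,q}=|\mathbb P^m|$. Distances are with respect to the Hamming metric; the relative distance is the minimum distance divided by the length. *)

theory Defs
  imports Complex_Main "HOL-Library.Poly_Mapping" "HOL-Library.FuncSet" "HOL-Library.Cardinality"
    "Jordan_Normal_Form.Matrix"
begin

section \<open>Projective space\<close>

definition nonzero_vecs :: "nat \<Rightarrow> 'a::field vec set" where
  "nonzero_vecs m = carrier_vec (Suc m) - {0\<^sub>v (Suc m)}"

definition proj_rel :: "nat \<Rightarrow> ('a::field vec \<times> 'a vec) set" where
  "proj_rel m = {(x, y). x \<in> nonzero_vecs m \<and> y \<in> nonzero_vecs m \<and> (\<exists>c. c \<noteq> 0 \<and> y = c \<cdot>\<^sub>v x)}"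

definition proj_space :: "nat \<Rightarrow> 'a::field vec set set" where
  "proj_space m = nonzero_vecs m // proj_rel m"

definition standard_vec :: "'a::field vec \<Rightarrow> bool" where
  "standard_vec x \<longleftrightarrow> (\<exists>i < dim_vec x. x $ i = 1 \<and> (\<forall>j < i. x $ j = 0))"

definition std_rep :: "'a::field vec set \<Rightarrow> 'a vec" where
  "std_rep P = (THE x. x \<in> P \<and> standard_vec x)"

definition theta :: "nat \<Rightarrow> nat \<Rightarrow> real" where
  "theta q m = (real q ^ (m + 1) - 1) / (real q - 1)"


section \<open>Multivariate polynomials\<close>

text \<open>A polynomial maps exponent vectors to coefficients; the variables are $X_0, X_1, \dots$.
  The bivariate ring in $S, T$ is the case $S = X_0$, $T = X_1$.\<close>

type_synonym 'a mvpoly = "(nat \<Rightarrow>\<^sub>0 nat) \<Rightarrow>\<^sub>0 'a"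

definition const_poly :: "'a::comm_semiring_1 \<Rightarrow> 'a mvpoly" where
  "const_poly c = Poly_Mapping.single 0 c"

definition var_poly :: "nat \<Rightarrow> 'a::comm_semiring_1 mvpoly" where
  "var_poly i = Poly_Mapping.single (Poly_Mapping.single i 1) 1"

definition mon_degree :: "(nat \<Rightarrow>\<^sub>0 nat) \<Rightarrow> nat" where
  "mon_degree u = (\<Sum>i \<in> Poly_Mapping.keys u. Poly_Mapping.lookup u i)"

definition homogeneous_polys :: "nat \<Rightarrow> nat \<Rightarrow> 'a::comm_semiring_1 mvpoly set" where
  "homogeneous_polys m v =
    {f. \<forall>u \<in> Poly_Mapping.keys f. Poly_Mapping.keys u \<subseteq> {..m} \<and> mon_degree u = v}"

definition eval_poly :: "'a::comm_semiring_1 mvpoly \<Rightarrow> 'a vec \<Rightarrow> 'a" where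
  "eval_poly f x = (\<Sum>u \<in> Poly_Mapping.keys f.
     Poly_Mapping.lookup f u * (\<Prod>i \<in> Poly_Mapping.keys u. x $ i ^ Poly_Mapping.lookup u i))"

definition subst_poly :: "'a::comm_semiring_1 mvpoly \<Rightarrow> (nat \<Rightarrow> 'a mvpoly) \<Rightarrow> 'a mvpoly" where
  "subst_poly f g = (\<Sum>u \<in> Poly_Mapping.keys f.
     const_poly (Poly_Mapping.lookup f u) *
     (\<Prod>i \<in> Poly_Mapping.keys u. g i ^ Poly_Mapping.lookup u i))"


section \<open>Linear embeddings of the projective line\<close>

definition proj_emb :: "nat \<Rightarrow> ('a::field vec \<Rightarrow> 'a vec) set" where
  "proj_emb m = {L. L \<in> carrier_vec 2 \<rightarrow> carrier_vec (m + 1) \<and>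
     (\<forall>x \<in> carrier_vec 2. \<forall>y \<in> carrier_vec 2. L (x + y) = L x + L y) \<and>
     (\<forall>c. \<forall>x \<in> carrier_vec 2. L (c \<cdot>\<^sub>v x) = c \<cdot>\<^sub>v L x) \<and>
     inj_on L (carrier_vec 2)}"

text \<open>$L(S,T)$ has the linear form $L(e_0)_i\,S + L(e_1)_i\,T$ as its $i$-th coordinate.\<close>

definition comp_poly :: "'a::field mvpoly \<Rightarrow> ('a vec \<Rightarrow> 'a vec) \<Rightarrow> 'a mvpoly" where
  "comp_poly f L = subst_poly f (\<lambda>i.
     const_poly (L (unit_vec 2 0) $ i) * var_poly 0 +
     const_poly (L (unit_vec 2 1) $ i) * var_poly 1)"


section \<open>Codes\<close>

text \<open>A word over a coordinate set \<open>I\<close> is a function that is \<open>undefined\<close> outside \<open>I\<close>.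
  The minimum distance is meaningful for codes with at least two words (\<open>Inf {} = 0\<close> on \<open>nat\<close>).\<close>

definition hamming_dist :: "'i set \<Rightarrow> ('i \<Rightarrow> 'a) \<Rightarrow> ('i \<Rightarrow> 'a) \<Rightarrow> nat" where
  "hamming_dist I c c' = card {i \<in> I. c i \<noteq> c' i}"

definition min_dist :: "'i set \<Rightarrow> ('i \<Rightarrow> 'a) set \<Rightarrow> nat" where
  "min_dist I C = Inf {hamming_dist I c c' | c c'. c \<in> C \<and> c' \<in> C \<and> c \<noteq> c'}"

definition rel_dist :: "'i set \<Rightarrow> ('i \<Rightarrow> 'a) set \<Rightarrow> real" where
  "rel_dist I C = real (min_dist I C) / real (card I)"

definition ev :: "nat \<Rightarrow> 'a::field mvpoly \<Rightarrow> 'a vec set \<Rightarrow> 'a" where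
  "ev m f = (\<lambda>P \<in> proj_space m. eval_poly f (std_rep P))"

definition PRS :: "nat \<Rightarrow> ('a::field vec set \<Rightarrow> 'a) set" where
  "PRS k = {ev 1 g | g. g \<in> homogeneous_polys 1 k}"

definition PLift :: "nat \<Rightarrow> nat \<Rightarrow> ('a::{finite,field} vec set \<Rightarrow> 'a) set" where
  "PLift m k = {ev m f | f.
     f \<in> homogeneous_polys m (k + (m - 1) * (CARD('a) - 1)) \<and>
     (\<forall>L \<in> proj_emb m. ev 1 (comp_poly f L) \<in> PRS k)}"

end

theory Submission
  imports Defs "HOL-Computational_Algebra.Polynomial"
begin

text \<open>Let \<open>F\<close> be the difference of the polynomials of two distinct words of \<open>PLift\<close>, and let
  \<open>F p \<noteq> 0\<close>. On the line through \<open>p\<close> and another point \<open>y\<close>, the values of \<open>F\<close> at the points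
  \<open>y + a p\<close> are those of a univariate polynomial in \<open>a\<close> of degree exactly \<open>k\<close>, because
  the coefficient of \<open>a^k\<close> is the value at the point at infinity \<open>p\<close>. So at least
  \<open>q - k = d - 1\<close> of them are non-zero. Instead of counting lines through \<open>p\<close>, the pairs
  \<open>(y, a)\<close> are counted twice over the vectors \<open>y\<close> outside the span of \<open>p\<close>. The code is not
  trivial since it contains the word of \<open>X\<^sub>0\<close> raised to the power \<open>k + (m - 1)(q - 1)\<close>, which
  agrees with \<open>X\<^sub>0^k\<close> as a function.\<close>

section \<open>Evaluation of polynomials\<close>

lemma poly_mapping_sum_single:
  "f = (\<Sum>u\<in>Poly_Mapping.keys f. Poly_Mapping.single u (Poly_Mapping.lookup f u))"
  by (rule poly_mapping_eqI) (auto simp: lookup_sum lookup_single when_def in_keys_iff)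

definition eval_mon :: "(nat \<Rightarrow>\<^sub>0 nat) \<Rightarrow> 'a::comm_semiring_1 vec \<Rightarrow> 'a" where
  "eval_mon u x = (\<Prod>i \<in> Poly_Mapping.keys u. x $ i ^ Poly_Mapping.lookup u i)"

text \<open>Indices outside \<open>keys u\<close> have exponent 0 and contribute the factor 1. A
  common index set is what allows monomials with different supports to be multiplied factor by
  factor.\<close>

lemma eval_mon_superset:
  assumes "finite A" "Poly_Mapping.keys u \<subseteq> A"
  shows "eval_mon u x = (\<Prod>i\<in>A. x $ i ^ Poly_Mapping.lookup u i)"
  unfolding eval_mon_def
  by (rule prod.mono_neutral_left) (use assms in \<open>auto simp: in_keys_iff\<close>)

lemma eval_mon_add: "eval_mon (u + w) x = eval_mon u x * eval_mon w x"
proof -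
  let ?A = "Poly_Mapping.keys u \<union> Poly_Mapping.keys w"
  have "eval_mon (u + w) x = (\<Prod>i\<in>?A. x $ i ^ Poly_Mapping.lookup (u + w) i)"
    by (rule eval_mon_superset) (use Poly_Mapping.keys_add[of u w] in auto)
  also have "\<dots> = eval_mon u x * eval_mon w x"
    by (simp add: eval_mon_superset[of ?A] lookup_add power_add prod.distrib)
  finally show ?thesis .
qed

lemma eval_poly_alt:
  "eval_poly f x = (\<Sum>u\<in>Poly_Mapping.keys f. Poly_Mapping.lookup f u * eval_mon u x)"
  by (simp add: eval_poly_def eval_mon_def)

lemma eval_poly_zero [simp]: "eval_poly 0 x = 0"
  by (simp add: eval_poly_alt)

lemma eval_poly_single: "eval_poly (Poly_Mapping.single u c) x = c * eval_mon u x"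
  by (simp add: eval_poly_alt)

lemma eval_poly_add: "eval_poly (f + g) x = eval_poly f x + eval_poly g x"
  unfolding eval_poly_alt
  by (rule setsum_keys_plus_distrib) (auto simp: algebra_simps)

lemma eval_poly_diff:
  fixes f :: "'a::comm_ring_1 mvpoly"
  shows "eval_poly (f - g) x = eval_poly f x - eval_poly g x"
  using eval_poly_add[of "f - g" g x] by simp

lemma eval_poly_sum: "eval_poly (sum f A) x = (\<Sum>i\<in>A. eval_poly (f i) x)"
  by (induction A rule: infinite_finite_induct) (auto simp: eval_poly_add)

text \<open>Cancellation can make the support of \<open>f * g\<close> smaller than the set of sums
  of exponents. Writing both factors as sums of single terms avoids describing that support.\<close>

lemma eval_poly_mult: "eval_poly (f * g) x = eval_poly f x * eval_poly g x"
proof -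
  have "f * g = (\<Sum>u\<in>Poly_Mapping.keys f. \<Sum>w\<in>Poly_Mapping.keys g.
      Poly_Mapping.single (u + w) (Poly_Mapping.lookup f u * Poly_Mapping.lookup g w))"
    by (subst poly_mapping_sum_single[of f], subst poly_mapping_sum_single[of g])
       (simp add: sum_product mult_single)
  then show ?thesis
    by (simp add: eval_poly_sum eval_poly_single eval_mon_add eval_poly_alt[of f]
        eval_poly_alt[of g] sum_product mult_ac)
qed

lemma eval_poly_const [simp]: "eval_poly (const_poly c) x = c"
  by (simp add: const_poly_def eval_poly_single eval_mon_def)

lemma eval_poly_one [simp]: "eval_poly 1 x = 1"
  using eval_poly_const[of 1 x] by (simp add: const_poly_def single_one)

lemma eval_poly_var [simp]: "eval_poly (var_poly i) x = x $ i"
  by (simp add: var_poly_def eval_poly_single eval_mon_def)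

lemma eval_poly_prod: "eval_poly (prod f A) x = (\<Prod>i\<in>A. eval_poly (f i) x)"
  by (induction A rule: infinite_finite_induct) (auto simp: eval_poly_mult)

lemma eval_poly_power: "eval_poly (f ^ n) x = eval_poly f x ^ n"
  by (induction n) (auto simp: eval_poly_mult)

lemma eval_poly_subst:
  "eval_poly (subst_poly f g) x =
    (\<Sum>u \<in> Poly_Mapping.keys f. Poly_Mapping.lookup f u *
       (\<Prod>i \<in> Poly_Mapping.keys u. eval_poly (g i) x ^ Poly_Mapping.lookup u i))"
  by (simp add: subst_poly_def eval_poly_sum eval_poly_mult eval_poly_prod eval_poly_power)

lemma homogeneous_polysD:
  assumes "f \<in> homogeneous_polys m v" "u \<in> Poly_Mapping.keys f"
  shows "Poly_Mapping.keys u \<subseteq> {..m}" "mon_degree u = v"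
  using assms by (auto simp: homogeneous_polys_def)

lemma homogeneous_polys_diff:
  fixes f :: "'a::comm_ring_1 mvpoly"
  assumes "f \<in> homogeneous_polys m v" "g \<in> homogeneous_polys m v"
  shows "f - g \<in> homogeneous_polys m v"
proof -
  have "Poly_Mapping.keys (f - g) \<subseteq> Poly_Mapping.keys f \<union> Poly_Mapping.keys g"
    by (rule keys_diff)
  then show ?thesis
    using assms unfolding homogeneous_polys_def by blast
qed

text \<open>For \<open>c\<close> other than 0 in a field, this makes vanishing a property of the
  projective point and not of the chosen vector, which is used whenever vectors are counted instead
  of points.\<close>

lemma eval_poly_smult:
  assumes "f \<in> homogeneous_polys m v" "x \<in> carrier_vec (Suc m)"
  shows "eval_poly f (c \<cdot>\<^sub>v x) = c ^ v * eval_poly f x"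
proof -
  have "eval_mon u (c \<cdot>\<^sub>v x) = c ^ v * eval_mon u x" if "u \<in> Poly_Mapping.keys f" for u
  proof -
    have "eval_mon u (c \<cdot>\<^sub>v x) =
        (\<Prod>i \<in> Poly_Mapping.keys u. (c * x $ i) ^ Poly_Mapping.lookup u i)"
      unfolding eval_mon_def
      by (rule prod.cong) (use homogeneous_polysD(1)[OF assms(1) that] assms(2) in auto)
    also have "\<dots> = c ^ mon_degree u * eval_mon u x"
      by (simp add: power_mult_distrib prod.distrib eval_mon_def mon_degree_def power_sum)
    finally show ?thesis
      using homogeneous_polysD(2)[OF assms(1) that] by simp
  qed
  then show ?thesis
    by (simp add: eval_poly_alt sum_distrib_left mult_ac)
qed

section \<open>Composition with embeddings of the projective line\<close>

lemma carrier_vec_2_decomp: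
  fixes x :: "'a::field vec"
  assumes "x \<in> carrier_vec 2"
  shows "x = x $ 0 \<cdot>\<^sub>v unit_vec 2 0 + x $ 1 \<cdot>\<^sub>v unit_vec 2 1"
  using assms by (intro eq_vecI) (auto simp: unit_vec_def less_2_cases_iff)

lemma proj_emb_decomp:
  assumes "L \<in> proj_emb m" "x \<in> carrier_vec 2"
  shows "L x = x $ 0 \<cdot>\<^sub>v L (unit_vec 2 0) + x $ 1 \<cdot>\<^sub>v L (unit_vec 2 1)"
proof -
  have "L x = L (x $ 0 \<cdot>\<^sub>v unit_vec 2 0 + x $ 1 \<cdot>\<^sub>v unit_vec 2 1)"
    using carrier_vec_2_decomp[OF assms(2)] by simp
  also have "\<dots> = L (x $ 0 \<cdot>\<^sub>v unit_vec 2 0) + L (x $ 1 \<cdot>\<^sub>v unit_vec 2 1)"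
    using assms(1) unfolding proj_emb_def by auto
  also have "\<dots> = x $ 0 \<cdot>\<^sub>v L (unit_vec 2 0) + x $ 1 \<cdot>\<^sub>v L (unit_vec 2 1)"
    using assms(1) unfolding proj_emb_def by auto
  finally show ?thesis .
qed

text \<open>Homogeneity enters only through the bound on the variables: all of them are among
  \<open>0..m\<close>, so every coordinate that is read lies within the dimension of
  \<open>L x\<close>.\<close>

lemma eval_poly_comp:
  assumes "f \<in> homogeneous_polys m v" "L \<in> proj_emb m" "x \<in> carrier_vec 2"
  shows "eval_poly (comp_poly f L) x = eval_poly f (L x)"
proof -
  have carrier: "L (unit_vec 2 0) \<in> carrier_vec (m + 1)" "L (unit_vec 2 1) \<in> carrier_vec (m + 1)"
    using assms(2) unfolding proj_emb_def by auto
  have "L x $ i = L (unit_vec 2 0) $ i * x $ 0 + L (unit_vec 2 1) $ i * x $ 1" if "i \<le> m" for i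
    using carrier that by (simp add: proj_emb_decomp[OF assms(2,3)] mult.commute)
  then have "eval_poly f (L x) = (\<Sum>u \<in> Poly_Mapping.keys f. Poly_Mapping.lookup f u *
      (\<Prod>i \<in> Poly_Mapping.keys u. (L (unit_vec 2 0) $ i * x $ 0 + L (unit_vec 2 1) $ i * x $ 1) ^
        Poly_Mapping.lookup u i))"
    unfolding eval_poly_def
    by (intro sum.cong arg_cong2[of _ _ _ _ "(*)"] prod.cong refl)
       (use homogeneous_polysD(1)[OF assms(1)] in
         \<open>auto simp: subset_iff\<close>)
  then show ?thesis
    by (simp add: comp_poly_def eval_poly_subst eval_poly_add eval_poly_mult)
qed

section \<open>Standard representatives\<close>

definition std_vecs :: "nat \<Rightarrow> 'a::field vec set" where
  "std_vecs m = {x \<in> carrier_vec (Suc m). standard_vec x}"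

lemma std_vecs_nonzero: "std_vecs m \<subseteq> nonzero_vecs m"
  by (auto simp: std_vecs_def nonzero_vecs_def standard_vec_def)

text \<open>The leading positions agree, since at the smaller of two distinct ones exactly one side
  would vanish. At the common leading position both vectors have entry 1, which identifies the
  scalars.\<close>

lemma smult_standard_vec_unique:
  fixes x y :: "'a::field vec"
  assumes "standard_vec x" "standard_vec y" "c \<noteq> 0" "e \<noteq> 0" "c \<cdot>\<^sub>v x = e \<cdot>\<^sub>v y"
  shows "c = e" "x = y"
proof -
  obtain i where i: "i < dim_vec x" "x $ i = 1" "\<forall>l<i. x $ l = 0"
    using assms(1) unfolding standard_vec_def by blast
  obtain j where j: "j < dim_vec y" "y $ j = 1" "\<forall>l<j. y $ l = 0"
    using assms(2) unfolding standard_vec_def by blast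
  have dim: "dim_vec x = dim_vec y"
    using arg_cong[OF assms(5), of dim_vec] by simp
  have eq: "c * x $ l = e * y $ l" if "l < dim_vec x" for l
    using arg_cong[OF assms(5), of "\<lambda>v. v $ l"] that dim by simp
  have "i = j"
  proof (rule linorder_cases[of i j])
    assume "i < j"
    then show ?thesis using eq[of i] i j assms(3,4) by simp
  next
    assume "j < i"
    then show ?thesis using eq[of j] i j dim assms(3,4) by simp
  qed
  then show "c = e"
    using eq[of i] i j by simp
  then show "x = y"
    using eq assms(4) dim by (intro eq_vecI) auto
qed

text \<open>Divide by the leftmost non-zero coordinate.\<close>

lemma nonzero_vecs_standard:
  fixes x :: "'a::field vec"
  assumes "x \<in> nonzero_vecs m"
  obtains c y where "c \<noteq> 0" "y \<in> std_vecs m" "x = c \<cdot>\<^sub>v y"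
proof -
  have x: "x \<in> carrier_vec (Suc m)" "x \<noteq> 0\<^sub>v (Suc m)"
    using assms by (auto simp: nonzero_vecs_def)
  then have ex: "\<exists>i. i < Suc m \<and> x $ i \<noteq> 0"
    by (metis carrier_vecD eq_vecI index_zero_vec)
  define i where "i = (LEAST i. i < Suc m \<and> x $ i \<noteq> 0)"
  have i: "i < Suc m" "x $ i \<noteq> 0"
    using LeastI_ex[OF ex] by (auto simp: i_def)
  have less: "x $ j = 0" if "j < i" for j
    using not_less_Least[of j "\<lambda>i. i < Suc m \<and> x $ i \<noteq> 0"] that i by (auto simp: i_def)
  show thesis
  proof
    show "x $ i \<noteq> 0" by fact
    show "inverse (x $ i) \<cdot>\<^sub>v x \<in> std_vecs m"
      unfolding std_vecs_def standard_vec_def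
      using x i less by (auto intro!: exI[of _ i])
    show "x = x $ i \<cdot>\<^sub>v (inverse (x $ i) \<cdot>\<^sub>v x)"
      using i by (simp add: smult_smult_assoc)
  qed
qed

lemma equiv_proj_rel: "equiv (nonzero_vecs m) (proj_rel m :: ('a::field vec \<times> 'a vec) set)"
proof (rule equivI)
  show "refl_on (nonzero_vecs m) (proj_rel m)"
    unfolding refl_on_def proj_rel_def by (auto intro!: exI[of _ 1])
  show "proj_rel m \<subseteq> nonzero_vecs m \<times> nonzero_vecs m"
    by (auto simp: proj_rel_def)
  show "sym (proj_rel m :: ('a vec \<times> 'a vec) set)"
  proof (rule symI)
    fix x y :: "'a vec" assume "(x, y) \<in> proj_rel m"
    then obtain c where c: "x \<in> nonzero_vecs m" "y \<in> nonzero_vecs m" "c \<noteq> 0" "y = c \<cdot>\<^sub>v x"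
      by (auto simp: proj_rel_def)
    then have "x = inverse c \<cdot>\<^sub>v y"
      by (simp add: smult_smult_assoc)
    then show "(y, x) \<in> proj_rel m"
      using c unfolding proj_rel_def by (metis (mono_tags, lifting) case_prodI inverse_nonzero_iff_nonzero mem_Collect_eq)
  qed
  show "trans (proj_rel m :: ('a vec \<times> 'a vec) set)"
    unfolding trans_def proj_rel_def by (auto simp: smult_smult_assoc) (metis mult_eq_0_iff)
qed

lemma std_rep_class:
  fixes y :: "'a::field vec"
  assumes "y \<in> std_vecs m"
  shows "std_rep (proj_rel m `` {y}) = y"
  unfolding std_rep_def
proof (rule the_equality)
  have "(y, y) \<in> proj_rel m"
    using assms std_vecs_nonzero equiv_class_self[OF equiv_proj_rel] by blast
  then show "y \<in> proj_rel m `` {y} \<and> standard_vec y"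
    using assms by (auto simp: std_vecs_def)
next
  fix x assume "x \<in> proj_rel m `` {y} \<and> standard_vec x"
  then obtain c where "c \<noteq> 0" "x = c \<cdot>\<^sub>v y" "standard_vec x"
    by (auto simp: proj_rel_def)
  then show "x = y"
    using smult_standard_vec_unique(2)[of x y 1 c] assms by (auto simp: std_vecs_def)
qed

text \<open>From here on, points can be replaced by their standard vectors, so that no later count
  has to handle equivalence classes.\<close>

lemma bij_betw_std_rep: "bij_betw std_rep (proj_space m) (std_vecs m :: 'a::field vec set)"
proof (rule bij_betw_byWitness[where f' = "\<lambda>y. proj_rel m `` {y}"])
  have ex_std: "\<exists>y\<in>std_vecs m. P = proj_rel m `` {y}" if "P \<in> proj_space m" for P :: "'a vec set"
  proof -
    from that have "P \<in> nonzero_vecs m // proj_rel m"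
      by (simp add: proj_space_def)
    then obtain x where x: "x \<in> nonzero_vecs m" "P = proj_rel m `` {x}"
      by (rule quotientE)
    obtain c y where y: "c \<noteq> 0" "y \<in> std_vecs m" "x = c \<cdot>\<^sub>v y"
      using nonzero_vecs_standard[OF x(1)] .
    then have "(y, x) \<in> proj_rel m"
      using x std_vecs_nonzero by (auto simp: proj_rel_def)
    then show ?thesis
      using equiv_class_eq[OF equiv_proj_rel] x y by blast
  qed
  show "\<forall>P\<in>proj_space m. proj_rel m `` {std_rep P} = (P :: 'a vec set)"
    using ex_std std_rep_class by metis
  show "\<forall>y\<in>std_vecs m. std_rep (proj_rel m `` {y}) = (y :: 'a vec)"
    using std_rep_class by blast
  show "std_rep ` proj_space m \<subseteq> (std_vecs m :: 'a vec set)"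
    using ex_std std_rep_class by fastforce
  show "(\<lambda>y. proj_rel m `` {y}) ` std_vecs m \<subseteq> (proj_space m :: 'a vec set set)"
    using std_vecs_nonzero by (auto simp: proj_space_def intro: quotientI)
qed

section \<open>Counting points through vectors\<close>

lemma card_proj_space_filter:
  "card {P \<in> proj_space m. R (std_rep P)} = card {y \<in> std_vecs m :: 'a::field vec set. R y}"
proof (rule bij_betw_same_card, rule bij_betw_subset[OF bij_betw_std_rep])
  have "std_rep ` proj_space m = (std_vecs m :: 'a vec set)"
    using bij_betw_std_rep by (rule bij_betw_imp_surj_on)
  then show "std_rep ` {P \<in> proj_space m. R (std_rep P)} = {y \<in> std_vecs m. R (y :: 'a vec)}"
    by auto
qed auto

lemma hamming_dist_ev:
  "hamming_dist (proj_space m) (ev m f) (ev m g) =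
    card {y \<in> std_vecs m :: 'a::field vec set. eval_poly (f - g) y \<noteq> 0}"
proof -
  have "{P \<in> proj_space m. ev m f P \<noteq> ev m g P} =
      {P \<in> proj_space m. eval_poly (f - g) (std_rep P) \<noteq> 0}"
    by (auto simp: ev_def eval_poly_diff)
  then show ?thesis
    unfolding hamming_dist_def by (simp add: card_proj_space_filter[of m "\<lambda>x. eval_poly (f - g) x \<noteq> 0"])
qed

lemma ev_neqD:
  assumes "ev m f \<noteq> ev m g"
  shows "\<exists>y \<in> std_vecs m :: 'a::field vec set. eval_poly (f - g) y \<noteq> 0"
proof -
  obtain P where "P \<in> proj_space m" "ev m f P \<noteq> ev m g P"
    using assms by (metis ev_def ext restrict_apply)
  then show ?thesis
    using bij_betw_std_rep[of m, THEN bij_betwE]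
    by (intro bexI[of _ "std_rep P"]) (auto simp: ev_def eval_poly_diff)
qed

text \<open>Every non-zero vector is a unique non-zero multiple of a unique standard vector, and the
  property \<open>R\<close> is constant along these multiples. This converts weights of codewords
  into counts of vectors.\<close>

lemma card_nonzero_vecs_filter:
  fixes R :: "'a::{finite,field} vec \<Rightarrow> bool"
  assumes "\<And>c x. c \<noteq> 0 \<Longrightarrow> x \<in> carrier_vec (Suc m) \<Longrightarrow> R (c \<cdot>\<^sub>v x) \<longleftrightarrow> R x"
  shows "card {x \<in> nonzero_vecs m. R x} = (CARD('a) - 1) * card {y \<in> std_vecs m. R y}"
proof -
  have "bij_betw (\<lambda>(c, y). c \<cdot>\<^sub>v y) ((UNIV - {0}) \<times> {y \<in> std_vecs m. R y})
      {x \<in> nonzero_vecs m. R x}"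
    unfolding bij_betw_def
  proof
    show "inj_on (\<lambda>(c, y). c \<cdot>\<^sub>v y) ((UNIV - {0}) \<times> {y \<in> std_vecs m. R y})"
    proof (rule inj_onI)
      fix s t :: "'a \<times> 'a vec"
      assume "s \<in> (UNIV - {0}) \<times> {y \<in> std_vecs m. R y}" "t \<in> (UNIV - {0}) \<times> {y \<in> std_vecs m. R y}"
        "(case s of (c, y) \<Rightarrow> c \<cdot>\<^sub>v y) = (case t of (c, y) \<Rightarrow> c \<cdot>\<^sub>v y)"
      then show "s = t"
        using smult_standard_vec_unique[of "snd s" "snd t" "fst s" "fst t"]
        by (cases s; cases t) (simp add: std_vecs_def)
    qed
    show "(\<lambda>(c, y). c \<cdot>\<^sub>v y) ` ((UNIV - {0}) \<times> {y \<in> std_vecs m. R y}) =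
        {x \<in> nonzero_vecs m. R x}"
    proof safe
      fix c :: 'a and y
      assume *: "c \<noteq> 0" "y \<in> std_vecs m" "R y"
      then have "y \<in> carrier_vec (Suc m)" "y \<noteq> 0\<^sub>v (Suc m)"
        using std_vecs_nonzero by (auto simp: nonzero_vecs_def)
      moreover have "y = inverse c \<cdot>\<^sub>v (c \<cdot>\<^sub>v y)"
        using * by (simp add: smult_smult_assoc)
      moreover have "inverse c \<cdot>\<^sub>v 0\<^sub>v (Suc m) = 0\<^sub>v (Suc m)"
        by (intro eq_vecI) auto
      ultimately show "c \<cdot>\<^sub>v y \<in> nonzero_vecs m"
        unfolding nonzero_vecs_def by (metis DiffI smult_carrier_vec singletonD)
      show "R (c \<cdot>\<^sub>v y)"
        using assms[of c y] * by (auto simp: std_vecs_def)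
    next
      fix x assume x: "x \<in> nonzero_vecs m" "R x"
      obtain c y where y: "c \<noteq> 0" "y \<in> std_vecs m" "x = c \<cdot>\<^sub>v y"
        using nonzero_vecs_standard[OF x(1)] .
      then have "R y"
        using assms[of c y] x by (auto simp: std_vecs_def)
      then show "x \<in> (\<lambda>(c, y). c \<cdot>\<^sub>v y) ` ((UNIV - {0}) \<times> {y \<in> std_vecs m. R y})"
        using y by force
    qed
  qed
  then have "card {x \<in> nonzero_vecs m. R x} =
      card ((UNIV - {0 :: 'a}) \<times> {y \<in> std_vecs m. R y})"
    by (rule bij_betw_same_card[symmetric])
  then show ?thesis
    by (simp add: card_cartesian_product)
qed

lemma bij_betw_vec_of_list: "bij_betw vec_of_list {xs. length xs = n} (carrier_vec n)"
proof (rule bij_betw_byWitness[where f' = list_of_vec])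
  show "vec_of_list ` {xs. length xs = n} \<subseteq> carrier_vec n"
    by (auto intro: carrier_vecI)
  show "list_of_vec ` carrier_vec n \<subseteq> {xs. length xs = n}"
    by auto
qed (auto simp only: vec_list list_vec)

lemma card_carrier_vec: "card (carrier_vec n :: 'a::finite vec set) = CARD('a) ^ n"
  using bij_betw_same_card[OF bij_betw_vec_of_list[where ?'a = 'a, of n]]
    card_lists_length_eq[of "UNIV :: 'a set" n] by simp

lemma finite_carrier_vec: "finite (carrier_vec n :: 'a::finite vec set)"
  by (rule card_ge_0_finite) (simp add: card_carrier_vec)

lemma card_nonzero_vecs:
  "card (nonzero_vecs m :: 'a::{finite,field} vec set) = CARD('a) ^ Suc m - 1"
  unfolding nonzero_vecs_def by (simp add: card_Diff_singleton card_carrier_vec)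

lemma card_field_ge_2: "2 \<le> CARD('a::{finite,field})"
proof -
  have "card {0, 1 :: 'a} \<le> CARD('a)"
    by (rule card_mono) auto
  then show ?thesis by simp
qed

lemma card_proj_space:
  "real (card (proj_space m :: 'a::{finite,field} vec set set)) = theta CARD('a) m"
proof -
  have "card (proj_space m :: 'a vec set set) = card (std_vecs m :: 'a vec set)"
    using bij_betw_std_rep by (rule bij_betw_same_card)
  then have "CARD('a) ^ Suc m - 1 = (CARD('a) - 1) * card (proj_space m :: 'a vec set set)"
    using card_nonzero_vecs_filter[where ?'a = 'a, of m "\<lambda>_. True"]
    by (simp add: card_nonzero_vecs)
  then have "real (CARD('a) ^ Suc m - 1) =
      real (CARD('a) - 1) * real (card (proj_space m :: 'a vec set set))"
    by (metis of_nat_mult)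
  then show ?thesis
    using card_field_ge_2[where ?'a = 'a] by (simp add: theta_def of_nat_diff field_simps)
qed

section \<open>Projective Reed-Solomon codes\<close>

text \<open>The value at a standard vector of the homogenization of \<open>p\<close> to degree
  \<open>k\<close>: the affine point \<open>(1, a)\<close> gets \<open>poly p a\<close>, the point
  at infinity \<open>(0, 1)\<close> gets the coefficient of degree \<open>k\<close>. Only standard
  vectors of the line are relevant.\<close>

definition prs_value :: "nat \<Rightarrow> 'a::field poly \<Rightarrow> 'a vec \<Rightarrow> 'a" where
  "prs_value k p x = (if x $ 0 = 0 then coeff p k else poly p (x $ 1))"

definition line_vec :: "'a \<Rightarrow> 'a \<Rightarrow> 'a vec" where
  "line_vec s t = vec 2 (\<lambda>i. if i = 0 then s else t)"

lemma line_vec_simps [simp]: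
  "line_vec s t $ 0 = s" "line_vec s t $ Suc 0 = t" "line_vec s t \<in> carrier_vec 2"
  by (auto simp: line_vec_def)

text \<open>The line is its affine chart together with one point at infinity.\<close>

lemma std_vecs_1:
  "std_vecs 1 = insert (line_vec 0 1) (range (line_vec (1 :: 'a::field)))"
proof (intro equalityI subsetI)
  fix x :: "'a vec" assume "x \<in> std_vecs 1"
  then have "dim_vec x = 2" "standard_vec x"
    by (auto simp: std_vecs_def)
  then obtain i where x: "dim_vec x = 2" "i < 2" "x $ i = 1" "\<forall>j<i. x $ j = 0"
    unfolding standard_vec_def by auto
  have "x = line_vec (x $ 0) (x $ 1)"
    using x(1) by (intro eq_vecI) (auto simp: line_vec_def less_2_cases_iff)
  moreover have "x $ 0 = 1 \<or> x $ 0 = 0 \<and> x $ 1 = 1"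
    using x(2-4) by (cases "i = 0") (auto simp: less_2_cases_iff)
  ultimately show "x \<in> insert (line_vec 0 1) (range (line_vec 1))"
    by (metis insertI1 insertI2 rangeI)
next
  fix x :: "'a vec" assume "x \<in> insert (line_vec 0 1) (range (line_vec 1))"
  then show "x \<in> std_vecs 1"
    unfolding std_vecs_def standard_vec_def line_vec_def
    by (auto intro: exI[of _ 0] exI[of _ "Suc 0"])
qed

text \<open>Dehomogenize by setting the first variable to 1.\<close>

lemma homogeneous_binary_value:
  fixes g :: "'a::field mvpoly"
  assumes "g \<in> homogeneous_polys 1 k"
  shows "\<exists>p. degree p \<le> k \<and> (\<forall>x\<in>std_vecs 1. eval_poly g x = prs_value k p x)"
proof -
  define p where "p = (\<Sum>u\<in>Poly_Mapping.keys g.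
    monom (Poly_Mapping.lookup g u) (Poly_Mapping.lookup u 1))"
  have deg: "Poly_Mapping.lookup u 0 + Poly_Mapping.lookup u 1 = k"
    if "u \<in> Poly_Mapping.keys g" for u
  proof -
    have "mon_degree u = (\<Sum>i\<in>{..1}. Poly_Mapping.lookup u i)"
      unfolding mon_degree_def
      by (rule sum.mono_neutral_left)
         (use homogeneous_polysD(1)[OF assms that] in \<open>auto simp: in_keys_iff\<close>)
    then show ?thesis
      using homogeneous_polysD(2)[OF assms that] by (simp add: atMost_Suc)
  qed
  have mon: "eval_mon u x = x $ 0 ^ Poly_Mapping.lookup u 0 * x $ 1 ^ Poly_Mapping.lookup u 1"
    if "u \<in> Poly_Mapping.keys g" for u x
    using eval_mon_superset[OF _ homogeneous_polysD(1)[OF assms that], of x]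
    by (simp add: atMost_Suc mult.commute)
  have "degree p \<le> k"
    unfolding p_def
  proof (rule degree_sum_le)
    fix u assume "u \<in> Poly_Mapping.keys g"
    then show "degree (monom (Poly_Mapping.lookup g u) (Poly_Mapping.lookup u 1)) \<le> k"
      using order_trans[OF degree_monom_le] deg by (metis le_add2)
  qed auto
  moreover have "eval_poly g (line_vec 0 1) = prs_value k p (line_vec 0 1)"
  proof -
    \<comment> \<open>The convention \<open>0 ^ 0 = 1\<close> is essential: at infinity exactly the
      pure powers of the second variable survive, and these carry the top coefficient of
      \<open>p\<close>.\<close>
    have "(0 :: 'a) ^ Poly_Mapping.lookup u 0 = (if Poly_Mapping.lookup u 1 = k then 1 else 0)"
      if "u \<in> Poly_Mapping.keys g" for u
      using deg[OF that] by auto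
    then show ?thesis
      by (auto simp: eval_poly_alt prs_value_def p_def coeff_sum mon intro!: sum.cong)
  qed
  moreover have "eval_poly g (line_vec 1 a) = prs_value k p (line_vec 1 a)" for a
    by (simp add: eval_poly_alt prs_value_def p_def poly_sum poly_monom mon)
  ultimately show ?thesis
    by (intro exI[of _ p]) (auto simp: std_vecs_1[simplified])
qed

text \<open>Homogenize: the term of degree \<open>j\<close> is padded with the power
  \<open>k - j\<close> of the first variable.\<close>

lemma prs_value_homogeneous:
  fixes p :: "'a::field poly"
  assumes "degree p \<le> k"
  shows "\<exists>g \<in> homogeneous_polys 1 k. \<forall>x\<in>std_vecs 1. eval_poly g x = prs_value k p x"
proof -
  define e where "e j = Poly_Mapping.single 0 (k - j) + Poly_Mapping.single (1 :: nat) j" for j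
  define g where "g = (\<Sum>j\<le>k. Poly_Mapping.single (e j) (coeff p j))"
  have e: "Poly_Mapping.lookup (e j) 0 = k - j" "Poly_Mapping.lookup (e j) 1 = j"
      "Poly_Mapping.keys (e j) \<subseteq> {..1}" for j
    using Poly_Mapping.keys_add[of "Poly_Mapping.single 0 (k - j)" "Poly_Mapping.single (1 :: nat) j"]
    by (auto simp: e_def lookup_add lookup_single split: if_splits)
  have "mon_degree (e j) = k" if "j \<le> k" for j
  proof -
    have "mon_degree (e j) = (\<Sum>i\<in>{..1}. Poly_Mapping.lookup (e j) i)"
      unfolding mon_degree_def
      by (rule sum.mono_neutral_left) (use e(3) in \<open>auto simp: in_keys_iff\<close>)
    then show ?thesis
      using that e[of j] by (simp add: atMost_Suc)
  qed
  moreover have "Poly_Mapping.keys g \<subseteq> e ` {..k}"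
    unfolding g_def by (rule order_trans[OF keys_sum]) (auto split: if_splits)
  ultimately have hom: "g \<in> homogeneous_polys 1 k"
    using e(3) unfolding homogeneous_polys_def by blast
  have mon: "eval_mon (e j) x = x $ 0 ^ (k - j) * x $ 1 ^ j" for j and x :: "'a vec"
    using eval_mon_superset[OF _ e(3), of _ x] e[of j] by (simp add: atMost_Suc mult.commute)
  have "eval_poly g (line_vec 0 1) = prs_value k p (line_vec 0 1)"
  proof -
    have "eval_poly g (line_vec 0 1) = (\<Sum>j\<le>k. if j = k then coeff p j else 0)"
      unfolding g_def eval_poly_sum eval_poly_single mon
      by (intro sum.cong) auto
    then show ?thesis
      by (simp add: prs_value_def)
  qed
  moreover have "eval_poly g (line_vec 1 a) = prs_value k p (line_vec 1 a)" for a
  proof -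
    have "poly p a = poly (\<Sum>j\<le>k. monom (coeff p j) j) a"
      by (simp add: poly_as_sum_of_monoms'[OF assms])
    then show ?thesis
      by (simp add: g_def eval_poly_sum eval_poly_single mon prs_value_def poly_sum poly_monom)
  qed
  ultimately show ?thesis
    using hom by (intro bexI[of _ g]) (auto simp: std_vecs_1[simplified])
qed

text \<open>Here \<open>g\<close> is arbitrary. The criterion is applied to
  \<open>comp_poly f L\<close>, whose formal degree generally exceeds \<open>k\<close>; only its
  values matter, so its coefficients never have to be computed.\<close>

lemma ev_in_PRS_iff:
  fixes g :: "'a::field mvpoly"
  shows "ev 1 g \<in> PRS k \<longleftrightarrow>
    (\<exists>p. degree p \<le> k \<and> (\<forall>x\<in>std_vecs 1. eval_poly g x = prs_value k p x))"
    (is "_ \<longleftrightarrow> ?R")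
proof
  assume "ev 1 g \<in> PRS k"
  then obtain h where h: "h \<in> homogeneous_polys 1 k" "ev 1 g = ev 1 h"
    by (auto simp: PRS_def)
  have "eval_poly g x = eval_poly h x" if "x \<in> std_vecs 1" for x
  proof -
    have "x \<in> std_rep ` proj_space 1"
      using that by (simp only: bij_betw_imp_surj_on[OF bij_betw_std_rep])
    then obtain P where P: "P \<in> proj_space 1" "x = std_rep P"
      by blast
    then show ?thesis
      using fun_cong[OF h(2), of P] by (simp add: ev_def)
  qed
  then show ?R
    using homogeneous_binary_value[OF h(1)] by metis
next
  assume ?R
  then obtain p where p: "degree p \<le> k" "\<forall>x\<in>std_vecs 1. eval_poly g x = prs_value k p x"
    by blast
  obtain h where h: "h \<in> homogeneous_polys 1 k"
      "\<forall>x\<in>std_vecs 1. eval_poly h x = prs_value k p x"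
    using prs_value_homogeneous[OF p(1)] by blast
  have "ev 1 g = ev 1 h"
    unfolding ev_def
    by (rule restrict_ext) (use p h bij_betw_std_rep[of 1, THEN bij_betwE] in auto)
  then show "ev 1 g \<in> PRS k"
    using h by (auto simp: PRS_def)
qed

section \<open>Weights and minimum distance of projective Reed-Solomon codes\<close>

lemma card_poly_nonroots:
  fixes p :: "'a::{finite,field} poly"
  assumes "p \<noteq> 0"
  shows "CARD('a) - degree p \<le> card {a. poly p a \<noteq> 0}"
proof -
  have "card {a. poly p a \<noteq> 0} = CARD('a) - card {a. poly p a = 0}"
    by (subst card_Diff_subset[symmetric]) (auto intro: arg_cong[of _ _ card])
  then show ?thesis
    using card_poly_roots_bound[OF assms] by simp
qed

lemma card_prs_value_nonzero:
  fixes p :: "'a::{finite,field} poly"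
  shows "card {x \<in> std_vecs 1. prs_value k p x \<noteq> 0} =
    card {a. poly p a \<noteq> 0} + (if coeff p k = 0 then 0 else 1)"
proof -
  have inj: "inj (line_vec (1 :: 'a))"
    by (rule injI) (metis line_vec_simps(2))
  have "{x \<in> std_vecs 1. prs_value k p x \<noteq> 0} =
      line_vec 1 ` {a. poly p a \<noteq> 0} \<union> (if coeff p k = 0 then {} else {line_vec 0 1})"
    by (auto simp: std_vecs_1[simplified] prs_value_def)
  moreover have "line_vec 0 1 \<notin> line_vec (1 :: 'a) ` {a. poly p a \<noteq> 0}"
    by (metis imageE line_vec_simps(1) zero_neq_one)
  ultimately show ?thesis
    by (simp add: card_image[OF inj_on_subset[OF inj]])
qed

text \<open>If the word vanishes at infinity, the degree drops below \<open>k\<close> and one fewer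
  affine root is possible; otherwise the point at infinity itself contributes 1. Both cases give the
  same bound.\<close>

lemma PRS_weight:
  fixes p :: "'a::{finite,field} poly"
  assumes "degree p \<le> k" "1 \<le> k" "p \<noteq> 0"
  shows "CARD('a) + 1 - k \<le> card {x \<in> std_vecs 1. prs_value k p x \<noteq> 0}"
proof (cases "coeff p k = 0")
  case True
  then have "degree p \<noteq> k"
    using assms leading_coeff_0_iff by blast
  then have "CARD('a) + 1 - k \<le> CARD('a) - degree p"
    using assms(1) by simp
  then show ?thesis
    using card_poly_nonroots[OF assms(3)] True by (simp add: card_prs_value_nonzero[simplified])
next
  case False
  have "CARD('a) - k \<le> CARD('a) - degree p"
    using assms(1) by simp
  then show ?thesis
    using card_poly_nonroots[OF assms(3)] False by (simp add: card_prs_value_nonzero[simplified])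
qed

text \<open>The product of the monic linear factors at \<open>k\<close> distinct field elements; it
  gives a word of least weight.\<close>

lemma exists_poly_split:
  assumes "k \<le> CARD('a::{finite,field})"
  shows "\<exists>p :: 'a poly. degree p = k \<and> coeff p k = 1 \<and> card {a. poly p a \<noteq> 0} = CARD('a) - k"
proof -
  obtain A :: "'a set" where A: "card A = k"
    using obtain_subset_with_card_n[OF assms] by blast
  define p where "p = (\<Prod>a\<in>A. [:- a, 1:])"
  have deg: "degree p = k"
    using A by (simp add: p_def degree_prod_eq_sum_degree)
  have "lead_coeff p = 1"
    unfolding p_def lead_coeff_prod by simp
  moreover have "{a. poly p a \<noteq> 0} = UNIV - A"
    by (auto simp: p_def poly_prod)
  ultimately show ?thesis
    using A deg by (intro exI[of _ p]) (auto simp: card_Diff_subset)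
qed

lemma min_dist_PRS:
  assumes "1 \<le> k" "k \<le> CARD('a::{finite,field}) - 1"
  shows "min_dist (proj_space 1) (PRS k :: ('a vec set \<Rightarrow> 'a) set) = CARD('a) + 1 - k"
  unfolding min_dist_def
proof (rule cInf_eq_minimum)
  obtain p :: "'a poly" where p: "degree p = k" "coeff p k = 1"
      "card {a. poly p a \<noteq> 0} = CARD('a) - k"
    using exists_poly_split[where ?'a = 'a, of k] assms(2) by (meson diff_le_self order_trans)
  obtain g where g: "g \<in> homogeneous_polys 1 k"
      "\<forall>x\<in>std_vecs 1. eval_poly g x = prs_value k p x"
    using prs_value_homogeneous[of p k] p by auto
  have "hamming_dist (proj_space 1) (ev 1 g) (ev 1 0) =
      card {x \<in> std_vecs 1. prs_value k p x \<noteq> 0}"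
    unfolding hamming_dist_ev using g by (intro arg_cong[of _ _ card]) auto
  also have "\<dots> = CARD('a) + 1 - k"
    using p assms(2) by (simp add: card_prs_value_nonzero[simplified])
  finally have dist: "hamming_dist (proj_space 1) (ev 1 g) (ev 1 0) = CARD('a) + 1 - k" .
  \<comment> \<open>The computed distance is positive, so the two words do differ and form an
    admissible pair.\<close>
  have "hamming_dist (proj_space 1) (ev 1 g) (ev 1 0) \<noteq> 0"
    using dist assms by simp
  then have neq: "ev 1 g \<noteq> ev 1 0"
    by (auto simp: hamming_dist_def)
  have "ev 1 0 \<in> (PRS k :: ('a vec set \<Rightarrow> 'a) set)"
    unfolding PRS_def homogeneous_polys_def by force
  then show "CARD('a) + 1 - k \<in> {hamming_dist (proj_space 1) c c' | c c'.
      c \<in> (PRS k :: ('a vec set \<Rightarrow> 'a) set) \<and> c' \<in> PRS k \<and> c \<noteq> c'}"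
    using g dist neq unfolding PRS_def by (smt (verit) mem_Collect_eq)
next
  fix n assume "n \<in> {hamming_dist (proj_space 1) c c' | c c'.
      c \<in> (PRS k :: ('a vec set \<Rightarrow> 'a) set) \<and> c' \<in> PRS k \<and> c \<noteq> c'}"
  then obtain f g :: "'a mvpoly" where n: "n = hamming_dist (proj_space 1) (ev 1 f) (ev 1 g)"
      "f \<in> homogeneous_polys 1 k" "g \<in> homogeneous_polys 1 k" "ev 1 f \<noteq> ev 1 g"
    by (auto simp: PRS_def)
  obtain p where p: "degree p \<le> k" "\<forall>x\<in>std_vecs 1. eval_poly (f - g) x = prs_value k p x"
    using homogeneous_binary_value[OF homogeneous_polys_diff[OF n(2,3)]] by blast
  have "p \<noteq> 0"
  proof
    assume "p = 0"
    then have "prs_value k p x = 0" for x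
      by (simp add: prs_value_def)
    then show False
      using ev_neqD[OF n(4)] p(2) by metis
  qed
  then have "CARD('a) + 1 - k \<le> card {x \<in> std_vecs 1. prs_value k p x \<noteq> 0}"
    using PRS_weight[OF p(1) assms(1)] by blast
  also have "\<dots> = n"
    unfolding n(1) hamming_dist_ev using p(2) by (intro arg_cong[of _ _ card]) auto
  finally show "CARD('a) + 1 - k \<le> n" .
qed

section \<open>Lifted projective codes\<close>

text \<open>Multiplication by \<open>x\<close> permutes the non-zero elements, so their product,
  which is non-zero, can be cancelled.\<close>

lemma power_card_minus_one:
  fixes x :: "'a::{finite,field}"
  assumes "x \<noteq> 0"
  shows "x ^ (CARD('a) - 1) = 1"
proof -
  have "(\<Prod>y\<in>UNIV-{0}. x * y) = (\<Prod>y\<in>UNIV-{0}. y)"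
    by (rule prod.reindex_bij_witness[of _ "\<lambda>y. y / x" "\<lambda>y. x * y"]) (use assms in auto)
  then have "x ^ (CARD('a) - 1) * \<Prod>(UNIV - {0 :: 'a}) = \<Prod>(UNIV - {0})"
    by (simp add: prod.distrib)
  then show ?thesis by simp
qed

lemma degree_linear_power_le:
  fixes a b :: "'a::comm_ring_1"
  shows "degree ([:a, b:] ^ k) \<le> k"
  by (rule order_trans[OF degree_power_le]) auto

text \<open>Matches the value of the form \<open>(a S + b T)^k\<close> at infinity, as
  \<open>prs_value\<close> demands.\<close>

lemma coeff_linear_power_top:
  fixes a b :: "'a::comm_ring_1"
  shows "coeff ([:a, b:] ^ k) k = b ^ k"
proof (induction k)
  case (Suc k)
  have "coeff ([:a, b:] ^ k) (Suc k) = 0"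
    using degree_linear_power_le[of a b k] by (intro coeff_eq_0) simp
  with Suc show ?case by simp
qed simp

text \<open>An infimum over no pairs would be 0 and the distance bound would fail; hence two
  distinct words are exhibited. One of them is zero.\<close>

lemma PLift_nontrivial:
  assumes "1 \<le> k"
  shows "\<exists>c\<in>PLift m k. \<exists>c'\<in>PLift m k. (c :: 'a::{finite,field} vec set \<Rightarrow> 'a) \<noteq> c'"
proof -
  define v where "v = k + (m - 1) * (CARD('a) - 1)"
  define f :: "'a mvpoly" where "f = Poly_Mapping.single (Poly_Mapping.single 0 v) 1"
  have f: "f \<in> homogeneous_polys m v"
    by (auto simp: homogeneous_polys_def f_def mon_degree_def)
  have eval_f: "eval_poly f x = x $ 0 ^ k" for x
  proof (cases "x $ 0 = 0")
    \<comment> \<open>Both exponents are positive because \<open>1 \<le> k\<close>, so both sides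
      vanish.\<close>
    case True
    then show ?thesis
      using assms by (simp add: f_def eval_poly_single eval_mon_def v_def power_0_left)
  next
    case False
    then show ?thesis
      using assms by (simp add: f_def eval_poly_single eval_mon_def v_def power_add
          power_mult[of _ "CARD('a) - Suc 0"] power_card_minus_one[simplified]
          mult.commute[of "m - Suc 0"])
  qed
  have "ev 1 (comp_poly f L) \<in> PRS k" if L: "L \<in> proj_emb m" for L
  proof -
    define a b where "a = L (unit_vec 2 0) $ 0" and "b = L (unit_vec 2 1) $ 0"
    have car: "L (unit_vec 2 0) \<in> carrier_vec (m + 1)" "L (unit_vec 2 1) \<in> carrier_vec (m + 1)"
      using L unfolding proj_emb_def by auto
    have "eval_poly (comp_poly f L) x = prs_value k ([:a, b:] ^ k) x" if "x \<in> std_vecs 1" for x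
    proof -
      have x: "x \<in> carrier_vec 2"
        using that by (simp add: std_vecs_def numeral_2_eq_2)
      \<comment> \<open>The pullback takes the values of the \<open>k\<close>-th power of the linear
        form given by the zeroth coordinate of \<open>L\<close>.\<close>
      have "eval_poly (comp_poly f L) x = (x $ 0 * a + x $ 1 * b) ^ k"
        using car by (simp add: eval_poly_comp[OF f L x] eval_f proj_emb_decomp[OF L x] a_def b_def)
      then show ?thesis
        using that
        by (auto simp: std_vecs_1[simplified] prs_value_def coeff_linear_power_top)
    qed
    then show ?thesis
      unfolding ev_in_PRS_iff using degree_linear_power_le by blast
  qed
  then have "ev m f \<in> PLift m k"
    using f by (auto simp: PLift_def v_def)
  moreover have "ev m 0 \<in> (PLift m k :: ('a vec set \<Rightarrow> 'a) set)"
  proof -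
    have "ev 1 (comp_poly 0 L) \<in> PRS k" for L :: "'a vec \<Rightarrow> 'a vec"
      unfolding ev_in_PRS_iff
      by (rule exI[of _ 0]) (simp add: comp_poly_def subst_poly_def prs_value_def)
    then show ?thesis
      unfolding PLift_def homogeneous_polys_def
      by (auto intro!: exI[of _ "0 :: 'a mvpoly"])
  qed
  moreover have "ev m f \<noteq> ev m 0"
  proof -
    have "unit_vec (Suc m) 0 \<in> (std_vecs m :: 'a vec set)"
      by (auto simp: std_vecs_def standard_vec_def intro!: exI[of _ 0])
    moreover have "eval_poly (f - 0) (unit_vec (Suc m) 0 :: 'a vec) \<noteq> 0"
      by (simp add: eval_f)
    ultimately have "hamming_dist (proj_space m) (ev m f) (ev m 0) \<noteq> 0"
      unfolding hamming_dist_ev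
      by (subst card_0_eq) (auto intro: finite_subset[OF _ finite_carrier_vec] simp: std_vecs_def)
    then show ?thesis
      by (auto simp: hamming_dist_def)
  qed
  ultimately show ?thesis by blast
qed

section \<open>Lines through a point where the difference does not vanish\<close>

text \<open>The order of \<open>y\<close> and \<open>p\<close> is deliberate: the point at infinity
  \<open>(0, 1)\<close> is sent to \<open>p\<close>, and the affine point \<open>(1, a)\<close> to
  \<open>y + a p\<close>. Injectivity is the linear independence of \<open>y\<close> and
  \<open>p\<close>.\<close>

lemma plane_embedding:
  fixes p y :: "'a::field vec"
  assumes p: "p \<in> nonzero_vecs m" and y: "y \<in> carrier_vec (Suc m)"
    and indep: "y \<notin> range (\<lambda>c. c \<cdot>\<^sub>v p)"
  shows "(\<lambda>x. x $ 0 \<cdot>\<^sub>v y + x $ 1 \<cdot>\<^sub>v p) \<in> proj_emb m"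
proof -
  have p': "p \<in> carrier_vec (Suc m)" "p \<noteq> 0\<^sub>v (Suc m)"
    using p by (auto simp: nonzero_vecs_def)
  have trivial: "s = 0 \<and> t = 0" if eq: "s \<cdot>\<^sub>v y + t \<cdot>\<^sub>v p = 0\<^sub>v (Suc m)" for s t
  proof -
    have coord: "s * y $ i + t * p $ i = 0" if "i < Suc m" for i
      using arg_cong[OF eq, of "\<lambda>v. v $ i"] that p' y by simp
    have "s = 0"
    proof (rule ccontr)
      assume "s \<noteq> 0"
      then have "y = (- t / s) \<cdot>\<^sub>v p"
        using coord p' y by (intro eq_vecI) (auto simp: field_simps add_eq_0_iff)
      then show False using indep by blast
    qed
    moreover have "t = 0"
    proof (rule ccontr)
      assume "t \<noteq> 0"
      then have "p = 0\<^sub>v (Suc m)"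
        using coord \<open>s = 0\<close> p' by (intro eq_vecI) auto
      then show False using p' by blast
    qed
    ultimately show ?thesis by blast
  qed
  let ?L = "\<lambda>x :: 'a vec. x $ 0 \<cdot>\<^sub>v y + x $ 1 \<cdot>\<^sub>v p"
  have "inj_on ?L (carrier_vec 2)"
  proof (rule inj_onI)
    fix x z :: "'a vec" assume xz: "x \<in> carrier_vec 2" "z \<in> carrier_vec 2" "?L x = ?L z"
    have coord: "x $ 0 * y $ i + x $ 1 * p $ i = z $ 0 * y $ i + z $ 1 * p $ i"
      if "i < Suc m" for i
      using arg_cong[OF xz(3), of "\<lambda>v. v $ i"] that p' y by simp
    have "(x $ 0 - z $ 0) \<cdot>\<^sub>v y + (x $ 1 - z $ 1) \<cdot>\<^sub>v p = 0\<^sub>v (Suc m)"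
      using coord p' y by (intro eq_vecI) (auto simp: algebra_simps)
    from trivial[OF this] show "x = z"
      using xz by (intro eq_vecI) (auto simp: less_2_cases_iff)
  qed
  moreover have "?L (x + z) = ?L x + ?L z" if "x \<in> carrier_vec 2" "z \<in> carrier_vec 2" for x z
    using that p' y by (intro eq_vecI) (auto simp: algebra_simps)
  moreover have "?L (c \<cdot>\<^sub>v x) = c \<cdot>\<^sub>v ?L x" if "x \<in> carrier_vec 2" for x c
    using that p' y by (intro eq_vecI) (auto simp: algebra_simps)
  ultimately show ?thesis
    unfolding proj_emb_def using p' y by auto
qed

lemma PLift_line_count:
  fixes f g :: "'a::{finite,field} mvpoly"
  assumes f: "f \<in> homogeneous_polys m v" and g: "g \<in> homogeneous_polys m v"
    and f_lift: "\<And>L. L \<in> proj_emb m \<Longrightarrow> ev 1 (comp_poly f L) \<in> PRS k"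
    and g_lift: "\<And>L. L \<in> proj_emb m \<Longrightarrow> ev 1 (comp_poly g L) \<in> PRS k"
    and p: "p \<in> nonzero_vecs m" "eval_poly (f - g) p \<noteq> 0"
    and y: "y \<in> carrier_vec (Suc m)" "y \<notin> range (\<lambda>c. c \<cdot>\<^sub>v p)"
  shows "CARD('a) - k \<le> card {a. eval_poly (f - g) (y + a \<cdot>\<^sub>v p) \<noteq> 0}"
proof -
  define L where "L = (\<lambda>x :: 'a vec. x $ 0 \<cdot>\<^sub>v y + x $ 1 \<cdot>\<^sub>v p)"
  have L: "L \<in> proj_emb m"
    unfolding L_def by (rule plane_embedding) (use p y in auto)
  have p': "p \<in> carrier_vec (Suc m)"
    using p by (auto simp: nonzero_vecs_def)
  obtain r where r: "degree r \<le> k"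
      "\<forall>x\<in>std_vecs 1. eval_poly (comp_poly f L) x = prs_value k r x"
    using f_lift[OF L] unfolding ev_in_PRS_iff by blast
  obtain s where s: "degree s \<le> k"
      "\<forall>x\<in>std_vecs 1. eval_poly (comp_poly g L) x = prs_value k s x"
    using g_lift[OF L] unfolding ev_in_PRS_iff by blast
  \<comment> \<open>\<open>prs_value\<close> is linear in its polynomial, so the two univariate
    polynomials may be subtracted.\<close>
  have diff: "eval_poly (f - g) (L x) = prs_value k (r - s) x" if "x \<in> std_vecs 1" for x
  proof -
    have "x \<in> carrier_vec 2"
      using that by (simp add: std_vecs_def numeral_2_eq_2)
    then show ?thesis
      using bspec[OF r(2) that] bspec[OF s(2) that] eval_poly_comp[OF f L] eval_poly_comp[OF g L]
      by (simp add: eval_poly_diff prs_value_def split: if_splits)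
  qed
  have "L (line_vec 0 1) = p"
    using p' y by (auto simp: L_def intro!: eq_vecI)
  \<comment> \<open>This coefficient is the value of \<open>f - g\<close> at \<open>p\<close>, the
    image of the point at infinity.\<close>
  then have "coeff (r - s) k \<noteq> 0"
    using diff[of "line_vec 0 1"] p(2) by (simp add: std_vecs_1[simplified] prs_value_def)
  then have "r - s \<noteq> 0"
    by auto
  then have card_ge: "CARD('a) - degree (r - s) \<le> card {a. poly (r - s) a \<noteq> 0}"
    by (rule card_poly_nonroots)
  have deg: "degree (r - s) \<le> k"
    using r(1) s(1) by (rule degree_diff_le)
  have "poly (r - s) a = eval_poly (f - g) (y + a \<cdot>\<^sub>v p)" for a
  proof -
    have "L (line_vec 1 a) = y + a \<cdot>\<^sub>v p"
      by (simp add: L_def)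
    then show ?thesis
      using diff[of "line_vec 1 a"] by (simp add: std_vecs_1[simplified] prs_value_def)
  qed
  then have "card {a. poly (r - s) a \<noteq> 0} = card {a. eval_poly (f - g) (y + a \<cdot>\<^sub>v p) \<noteq> 0}"
    by presburger
  then show ?thesis
    using card_ge deg by linarith
qed

text \<open>The bound on the distance multiplied by \<open>q - 1\<close>, with
  \<open>q ^ m - 1\<close> standing for \<open>(q - 1)\<close> times the number of points of a
  hyperplane when \<open>1 \<le> m\<close>. Counting vectors in this way needs no division.\<close>

lemma PLift_weight:
  fixes f g :: "'a::{finite,field} mvpoly"
  assumes f: "f \<in> homogeneous_polys m v" and g: "g \<in> homogeneous_polys m v"
    and f_lift: "\<And>L. L \<in> proj_emb m \<Longrightarrow> ev 1 (comp_poly f L) \<in> PRS k"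
    and g_lift: "\<And>L. L \<in> proj_emb m \<Longrightarrow> ev 1 (comp_poly g L) \<in> PRS k"
    and neq: "ev m f \<noteq> ev m g"
  shows "(CARD('a) ^ m - 1) * (CARD('a) - k) + (CARD('a) - 1) \<le>
    (CARD('a) - 1) * hamming_dist (proj_space m) (ev m f) (ev m g)"
proof -
  define F where "F = eval_poly (f - g)"
  let ?V = "carrier_vec (Suc m) :: 'a vec set"
  let ?q = "CARD('a)"
  have F_smult: "F (c \<cdot>\<^sub>v x) \<noteq> 0 \<longleftrightarrow> F x \<noteq> 0" if "c \<noteq> 0" "x \<in> ?V" for c x
    unfolding F_def using eval_poly_smult[OF homogeneous_polys_diff[OF f g] that(2)] that(1) by simp
  obtain p where p: "p \<in> nonzero_vecs m" "F p \<noteq> 0"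
    using ev_neqD[OF neq] std_vecs_nonzero unfolding F_def by blast
  then have p': "p \<in> ?V" "p \<noteq> 0\<^sub>v (Suc m)"
    by (auto simp: nonzero_vecs_def)
  define S where "S = range (\<lambda>c. c \<cdot>\<^sub>v p)"
  define A where "A = ?V - S"
  define N where "N = {x \<in> A. F x \<noteq> 0}"
  have inj: "inj (\<lambda>c. c \<cdot>\<^sub>v p)"
  proof (rule injI)
    fix c e assume eq: "c \<cdot>\<^sub>v p = e \<cdot>\<^sub>v p"
    obtain i where i: "i < Suc m" "p $ i \<noteq> 0"
      using p' by (metis carrier_vecD eq_vecI index_zero_vec)
    show "c = e"
      using arg_cong[OF eq, of "\<lambda>v. v $ i"] i p' by simp
  qed
  have S_sub: "S \<subseteq> ?V"
    using p' by (auto simp: S_def)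
  have card_S: "card S = ?q"
    unfolding S_def by (rule card_image[OF inj])
  have fin: "finite ?V" "finite A" "finite S"
    by (auto simp: A_def S_def finite_carrier_vec)
  have card_A: "card A = ?q ^ Suc m - ?q"
    unfolding A_def using S_sub fin by (simp add: card_Diff_subset card_carrier_vec card_S)
  \<comment> \<open>Translation by a multiple of \<open>p\<close> permutes the complement of the
    span of \<open>p\<close>, so the count does not depend on \<open>a\<close>.\<close>
  have translate: "card {y \<in> A. F (y + a \<cdot>\<^sub>v p) \<noteq> 0} = card N" for a
  proof (rule bij_betw_same_card[of "\<lambda>y. y + a \<cdot>\<^sub>v p"],
      rule bij_betw_byWitness[where f' = "\<lambda>y. y + (- a) \<cdot>\<^sub>v p"])
    have cancel: "y + a \<cdot>\<^sub>v p + (- a) \<cdot>\<^sub>v p = y" "y + (- a) \<cdot>\<^sub>v p + a \<cdot>\<^sub>v p = y" if "y \<in> ?V" for y a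
      using that p' by (auto intro!: eq_vecI)
    have shift: "y + a \<cdot>\<^sub>v p \<in> A" if "y \<in> A" for y a
    proof -
      have y: "y \<in> ?V" "y \<notin> S"
        using that by (auto simp: A_def)
      have "y + a \<cdot>\<^sub>v p \<notin> S"
      proof
        assume "y + a \<cdot>\<^sub>v p \<in> S"
        then obtain c where "y + a \<cdot>\<^sub>v p = c \<cdot>\<^sub>v p"
          by (auto simp: S_def)
        then have "y = c \<cdot>\<^sub>v p + (- a) \<cdot>\<^sub>v p"
          using cancel(1)[OF y(1), of a] by simp
        also have "\<dots> = (c - a) \<cdot>\<^sub>v p"
          using p' by (auto intro!: eq_vecI simp: algebra_simps)
        finally show False
          using y(2) by (auto simp: S_def)
      qed
      then show ?thesis
        using y p' by (simp add: A_def)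
    qed
    show "\<forall>y\<in>{y \<in> A. F (y + a \<cdot>\<^sub>v p) \<noteq> 0}. y + a \<cdot>\<^sub>v p + (- a) \<cdot>\<^sub>v p = y"
      using cancel by (auto simp: A_def)
    show "\<forall>y\<in>N. y + (- a) \<cdot>\<^sub>v p + a \<cdot>\<^sub>v p = y"
      using cancel by (auto simp: N_def A_def)
    show "(\<lambda>y. y + a \<cdot>\<^sub>v p) ` {y \<in> A. F (y + a \<cdot>\<^sub>v p) \<noteq> 0} \<subseteq> N"
      using shift by (auto simp: N_def)
    show "(\<lambda>y. y + (- a) \<cdot>\<^sub>v p) ` N \<subseteq> {y \<in> A. F (y + a \<cdot>\<^sub>v p) \<noteq> 0}"
    proof safe
      fix y assume y: "y \<in> N"
      then show "y + (- a) \<cdot>\<^sub>v p \<in> A"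
        using shift by (auto simp: N_def)
      assume "F (y + (- a) \<cdot>\<^sub>v p + a \<cdot>\<^sub>v p) = 0"
      then show False
        using y cancel(2)[of y a] by (auto simp: N_def A_def)
    qed
  qed
  have "card A * (?q - k) \<le> (\<Sum>y\<in>A. card {a. F (y + a \<cdot>\<^sub>v p) \<noteq> 0})"
  proof -
    have "(\<Sum>y\<in>A. ?q - k) \<le> (\<Sum>y\<in>A. card {a. F (y + a \<cdot>\<^sub>v p) \<noteq> 0})"
      unfolding F_def
      by (rule sum_mono, rule PLift_line_count[OF f g f_lift g_lift p[unfolded F_def]])
         (auto simp: A_def S_def)
    then show ?thesis by simp
  qed
  \<comment> \<open>Double counting: first over \<open>a\<close> for each \<open>y\<close>, then
    over \<open>y\<close> for each \<open>a\<close>.\<close>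
  also have "\<dots> = (\<Sum>a\<in>UNIV. card {y \<in> A. F (y + a \<cdot>\<^sub>v p) \<noteq> 0})"
    using sum_multicount_gen[of A "UNIV :: 'a set" "\<lambda>y a. F (y + a \<cdot>\<^sub>v p) \<noteq> 0"
        "\<lambda>a. card {y \<in> A. F (y + a \<cdot>\<^sub>v p) \<noteq> 0}"] fin
    by simp
  also have "\<dots> = ?q * card N"
    by (simp add: translate)
  finally have "(?q ^ Suc m - ?q) * (?q - k) \<le> ?q * card N"
    by (simp only: card_A)
  moreover have "?q ^ Suc m - ?q = ?q * (?q ^ m - 1)"
    by (simp add: diff_mult_distrib2)
  ultimately have N_ge: "(?q ^ m - 1) * (?q - k) \<le> card N"
    by (simp add: mult.assoc)
  \<comment> \<open>The \<open>q - 1\<close> non-zero multiples of \<open>p\<close> all count; after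
    division by \<open>q - 1\<close> they are the final \<open>+ 1\<close> of the distance
    bound.\<close>
  have "card {x \<in> nonzero_vecs m. F x \<noteq> 0} = card N + (?q - 1)"
  proof -
    have smult_zero: "0 \<cdot>\<^sub>v p = 0\<^sub>v (Suc m)"
      using p' by (intro eq_vecI) auto
    have S_F: "F x \<noteq> 0" if x: "x \<in> S - {0\<^sub>v (Suc m)}" for x
    proof -
      obtain c where c: "x = c \<cdot>\<^sub>v p" "x \<noteq> 0\<^sub>v (Suc m)"
        using x unfolding S_def by blast
      then have "c \<noteq> 0"
        using smult_zero by auto
      then show ?thesis using F_smult p p' c by simp
    qed
    have zero_S: "0\<^sub>v (Suc m) \<in> S"
      unfolding S_def using smult_zero by (metis rangeI)
    have "{x \<in> nonzero_vecs m. F x \<noteq> 0} = N \<union> (S - {0\<^sub>v (Suc m)})"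
      using S_sub S_F zero_S by (auto simp: nonzero_vecs_def N_def A_def)
    moreover have "card (N \<union> (S - {0\<^sub>v (Suc m)})) = card N + card (S - {0\<^sub>v (Suc m)})"
      using fin by (intro card_Un_disjoint) (auto simp: N_def A_def)
    ultimately show ?thesis
      using zero_S by (simp add: card_Diff_singleton card_S)
  qed
  moreover have "card {x \<in> nonzero_vecs m. F x \<noteq> 0} = (?q - 1) * card {y \<in> std_vecs m. F y \<noteq> 0}"
    by (rule card_nonzero_vecs_filter) (use F_smult in auto)
  ultimately show ?thesis
    using N_ge unfolding hamming_dist_ev F_def by simp
qed

text \<open>A non-empty set of natural numbers attains its infimum, so the weight bound applies to
  an actual pair of words.\<close>

lemma min_dist_PLift:
  assumes "1 \<le> k" "k \<le> CARD('a::{finite,field}) - 1"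
  shows "(CARD('a) ^ m - 1) * (CARD('a) - k) + (CARD('a) - 1) \<le>
    (CARD('a) - 1) * min_dist (proj_space m) (PLift m k :: ('a vec set \<Rightarrow> 'a) set)"
proof -
  let ?D = "{hamming_dist (proj_space m) c c' | c c'.
    c \<in> (PLift m k :: ('a vec set \<Rightarrow> 'a) set) \<and> c' \<in> PLift m k \<and> c \<noteq> c'}"
  have "?D \<noteq> {}"
    using PLift_nontrivial[OF assms(1), where ?'a = 'a, of m] by blast
  then have "min_dist (proj_space m) (PLift m k :: ('a vec set \<Rightarrow> 'a) set) \<in> ?D"
    unfolding min_dist_def by (rule Inf_nat_def1)
  then obtain f g :: "'a mvpoly" where
      "min_dist (proj_space m) (PLift m k :: ('a vec set \<Rightarrow> 'a) set) =
        hamming_dist (proj_space m) (ev m f) (ev m g)"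
      "f \<in> homogeneous_polys m (k + (m - 1) * (CARD('a) - 1))"
      "g \<in> homogeneous_polys m (k + (m - 1) * (CARD('a) - 1))"
      "\<forall>L \<in> proj_emb m. ev 1 (comp_poly f L) \<in> PRS k"
      "\<forall>L \<in> proj_emb m. ev 1 (comp_poly g L) \<in> PRS k"
      "ev m f \<noteq> ev m g"
    unfolding PLift_def by blast
  then show ?thesis
    using PLift_weight[of f m "k + (m - 1) * (CARD('a) - 1)" g k] by simp
qed

section \<open>Distance and relative distance bounds\<close>

theorem proposition57:
  fixes q m k d D :: nat and \<delta> \<Delta> :: real
  assumes "q = CARD('a::{finite,field})"
    and "1 \<le> m" and "1 \<le> k" and "k \<le> q - 1"
    and "d = min_dist (proj_space 1 :: 'a vec set set) (PRS k :: ('a vec set \<Rightarrow> 'a) set)"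
    and "D = min_dist (proj_space m :: 'a vec set set) (PLift m k :: ('a vec set \<Rightarrow> 'a) set)"
    and "\<delta> = rel_dist (proj_space 1 :: 'a vec set set) (PRS k :: ('a vec set \<Rightarrow> 'a) set)"
    and "\<Delta> = rel_dist (proj_space m :: 'a vec set set) (PLift m k :: ('a vec set \<Rightarrow> 'a) set)"
  shows "d = q + 1 - k \<and>
    real D \<ge> (real d - 1) * theta q (m - 1) + 1 \<and>
    \<delta> = real d / (real q + 1) \<and>
    \<Delta> = real D / theta q m \<and>
    (\<exists>b'::real. 0 \<le> b' \<and> b' \<le> 1 / real q \<and> \<Delta> \<ge> (1 - b') * \<delta> - b')"
proof -
  have q: "2 \<le> q"
    using card_field_ge_2[where ?'a = 'a] assms(1) by simp
  have d: "d = q + 1 - k"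
    using min_dist_PRS[where ?'a = 'a, of k] assms by simp
  then have d_real: "real d = real q + 1 - real k" "real (q - k) = real d - 1"
    using assms(4) q by (auto simp: of_nat_diff)
  have theta_nonneg: "0 \<le> theta q (m - 1)"
    using q one_le_power[of "real q" "m - 1 + 1"]
    unfolding theta_def by (intro divide_nonneg_nonneg) linarith+
  have theta_mult: "(real q - 1) * theta q (m - 1) = real q ^ m - 1"
    using q assms(2) by (simp add: theta_def)
  \<comment> \<open>A projective space is a point together with \<open>q\<close> further points on
    each line through it, and these lines are \<open>theta q (m - 1)\<close> in number.\<close>
  have theta_rec: "theta q m = real q * theta q (m - 1) + 1"
    using q assms(2) by (cases m) (auto simp: theta_def field_simps)
  have "real ((q ^ m - 1) * (q - k) + (q - 1)) \<le> real ((q - 1) * D)"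
    using min_dist_PLift[where ?'a = 'a, of k m] assms by (subst of_nat_le_iff) simp
  then have "(real q ^ m - 1) * (real d - 1) + (real q - 1) \<le> (real q - 1) * real D"
    using q d_real by (simp add: of_nat_diff)
  then have "(real q - 1) * ((real d - 1) * theta q (m - 1) + 1) \<le> (real q - 1) * real D"
    unfolding theta_mult[symmetric] by (simp add: algebra_simps)
  then have D: "(real d - 1) * theta q (m - 1) + 1 \<le> real D"
    using q by simp
  have "theta q 1 = real q + 1"
    using q by (simp add: theta_def field_simps power2_eq_square)
  then have \<delta>: "\<delta> = real d / (real q + 1)"
    using assms(1,5,7) card_proj_space[where ?'a = 'a, of 1] by (simp add: rel_dist_def)
  have \<Delta>: "\<Delta> = real D / theta q m"
    using assms(1,6,8) card_proj_space[where ?'a = 'a, of m] by (simp add: rel_dist_def)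
  \<comment> \<open>After cancellation this is \<open>d - 1 \<le> q\<close>, that is
    \<open>q - k \<le> q\<close>. With the bound on \<open>D\<close> it gives the clean estimate
    \<open>(d - 1) / q\<close> for the relative distance.\<close>
  have "(real d - 1) * (real q * theta q (m - 1) + 1) \<le>
      real q * ((real d - 1) * theta q (m - 1) + 1)"
    using d_real assms(3) by (simp add: algebra_simps)
  also have "\<dots> \<le> real q * real D"
    using D by (intro mult_left_mono) auto
  finally have "(real d - 1) / real q \<le> \<Delta>"
    unfolding \<Delta> theta_rec using q theta_nonneg
    by (simp add: field_simps add_pos_nonneg)
  \<comment> \<open>The choice \<open>b' = 1 / q\<close> suffices: dropping the factor
    \<open>1 - b'\<close> and replacing the denominator \<open>q + 1\<close> of
    \<open>\<delta>\<close> by \<open>q\<close> only increase the left side, and they end exactly at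
    \<open>(d - 1) / q\<close>.\<close>
  moreover have "(1 - 1 / real q) * \<delta> - 1 / real q \<le> (real d - 1) / real q"
  proof -
    have "(1 - 1 / real q) * \<delta> \<le> \<delta>"
      using q by (intro mult_left_le_one_le) (auto simp: \<delta>)
    also have "\<delta> \<le> real d / real q"
      unfolding \<delta> using q by (intro divide_left_mono) auto
    finally show ?thesis
      by (simp add: diff_divide_distrib)
  qed
  ultimately show ?thesis
    using d D \<delta> \<Delta> by (intro conjI exI[of _ "1 / real q"]) auto
qed

end
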